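(* Let $(G,q)$ and $(G',q')$ be two nondegenerate quadratic forms on finite abelian groups, with associated linking pairings $b$ and $b'$ respectively. The following two assertions are equivalent: (1) $(G,q)\simeq (G',q')$; (2) $(G,b) \simeq (G',b')$ and $B(q)=B(q') \in \mathbf{Z}_{8}$. Here $B(-)$ denotes the Gauss-Brown invariant of quadratic forms.
   Context: A linking pairing on a finite abelian group $G$ is a nondegenerate symmetric bilinear map $b:G\times G\to\mathbf{Q}/\mathbf{Z}$. A quadratic form on $G$ is a map $q:G\to\mathbf{Q}/\mathbf{Z}$ such that $b_q(x,y)=q(x+y)-q(x)-q(y)$ is bilinear and $q(-x)=q(x)$ for all $x\in G$; it is nondegenerate when its associated bilinear form $b_q$ is a linking pairing. $(G,q)\simeq(G',q')$ means there is a group isomorphism $\theta:G\to G'$ with $q=q'\circ\theta$; $(G,b)\simeq(G',b')$ means there is a group isomorphism $\theta$ with $b(x,y)=b'(\theta x,\theta y)$. The Gauss sum of $(G,q)$ is $\gamma(G,q)=\frac{1}{\sqrt{|\ker(b_q)|\cdot|G|}}\sum_{x\in G}e^{2i\pi q(x)}\in\mathbf{C}$; for $q$ nondegenerate it is an $8$th root of unity, and the Gauss-Brown invariant $B(q)=B(G,q)\in\mathbf{Z}_8$ is defined by $\gamma(G,q)=e^{\frac{2i\pi}{8}B(G,q)}$. *)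

theory Defs
  imports "HOL-Algebra.Algebra" "HOL-Library.Numeral_Type" "HOL-Analysis.Analysis"
begin

text \<open>Finite abelian groups are HOL-Algebra groups, hence written multiplicatively;
  the value group $\mathbf{Q}/\mathbf{Z}$ is an additive type.\<close>

quotient_type rat_mod_int = rat / "\<lambda>x y :: rat. x - y \<in> \<int>"
proof (rule equivpI)
  show "reflp (\<lambda>x y :: rat. x - y \<in> \<int>)"
    by (simp add: reflp_def)
  show "symp (\<lambda>x y :: rat. x - y \<in> \<int>)"
    by (rule sympI) (use Ints_minus in fastforce)
  show "transp (\<lambda>x y :: rat. x - y \<in> \<int>)"
  proof (rule transpI)
    fix x y z :: rat
    assume "x - y \<in> \<int>" and "y - z \<in> \<int>"
    then have "(x - y) + (y - z) \<in> \<int>"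
      by (rule Ints_add)
    then show "x - z \<in> \<int>"
      by simp
  qed
qed

instantiation rat_mod_int :: ab_group_add
begin

lift_definition zero_rat_mod_int :: rat_mod_int is "0" .

lift_definition plus_rat_mod_int :: "rat_mod_int \<Rightarrow> rat_mod_int \<Rightarrow> rat_mod_int" is "(+)"
proof -
  fix a b c d :: rat
  assume "a - b \<in> \<int>" and "c - d \<in> \<int>"
  then have "(a - b) + (c - d) \<in> \<int>"
    by (rule Ints_add)
  then show "(a + c) - (b + d) \<in> \<int>"
    by (simp add: algebra_simps)
qed

lift_definition uminus_rat_mod_int :: "rat_mod_int \<Rightarrow> rat_mod_int" is "uminus"
proof -
  fix a b :: rat
  assume "a - b \<in> \<int>"
  then have "- (a - b) \<in> \<int>"
    by (rule Ints_minus)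
  then show "- a - - b \<in> \<int>"
    by simp
qed

lift_definition minus_rat_mod_int :: "rat_mod_int \<Rightarrow> rat_mod_int \<Rightarrow> rat_mod_int" is "(-)"
proof -
  fix a b c d :: rat
  assume "a - b \<in> \<int>" and "c - d \<in> \<int>"
  then have "(a - b) - (c - d) \<in> \<int>"
    by (rule Ints_diff)
  then show "(a - c) - (b - d) \<in> \<int>"
    by (simp add: algebra_simps)
qed

instance
  by standard (transfer, simp add: algebra_simps)+

end

text \<open>The character $e^{2 i \pi x}$ of $\mathbf{Q}/\mathbf{Z}$.\<close>

lift_definition exp_2pi_i :: "rat_mod_int \<Rightarrow> complex"
  is "\<lambda>r. exp (2 * \<i> * of_real pi * of_rat r)"
proof -
  fix r s :: rat
  assume "r - s \<in> \<int>"
  then obtain k :: int where "r - s = of_int k"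
    by (rule Ints_cases)
  then have "r = s + of_int k"
    by (simp add: algebra_simps)
  then have "2 * \<i> * of_real pi * of_rat r
      = 2 * \<i> * of_real pi * of_rat s + 2 * of_int k * of_real pi * \<i>"
    by (simp add: of_rat_add algebra_simps)
  then show "exp (2 * \<i> * of_real pi * of_rat r) = exp (2 * \<i> * of_real pi * of_rat s)"
    by (auto simp: exp_eq)
qed

definition bilinear_map :: "('a, 'm) monoid_scheme \<Rightarrow> ('a \<Rightarrow> 'a \<Rightarrow> rat_mod_int) \<Rightarrow> bool" where
  "bilinear_map G b \<longleftrightarrow>
    (\<forall>x\<in>carrier G. \<forall>y\<in>carrier G. \<forall>z\<in>carrier G.
      b (x \<otimes>\<^bsub>G\<^esub> y) z = b x z + b y z \<and> b x (y \<otimes>\<^bsub>G\<^esub> z) = b x y + b x z)"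

definition bilinear_ker :: "('a, 'm) monoid_scheme \<Rightarrow> ('a \<Rightarrow> 'a \<Rightarrow> rat_mod_int) \<Rightarrow> 'a set" where
  "bilinear_ker G b = {x \<in> carrier G. \<forall>y\<in>carrier G. b x y = 0}"

definition linking_pairing :: "('a, 'm) monoid_scheme \<Rightarrow> ('a \<Rightarrow> 'a \<Rightarrow> rat_mod_int) \<Rightarrow> bool" where
  "linking_pairing G b \<longleftrightarrow>
    bilinear_map G b \<and>
    (\<forall>x\<in>carrier G. \<forall>y\<in>carrier G. b x y = b y x) \<and>
    bilinear_ker G b = {\<one>\<^bsub>G\<^esub>}"

definition assoc_bilinear ::
    "('a, 'm) monoid_scheme \<Rightarrow> ('a \<Rightarrow> rat_mod_int) \<Rightarrow> 'a \<Rightarrow> 'a \<Rightarrow> rat_mod_int" where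
  "assoc_bilinear G q x y = q (x \<otimes>\<^bsub>G\<^esub> y) - q x - q y"

definition quadratic_form :: "('a, 'm) monoid_scheme \<Rightarrow> ('a \<Rightarrow> rat_mod_int) \<Rightarrow> bool" where
  "quadratic_form G q \<longleftrightarrow>
    bilinear_map G (assoc_bilinear G q) \<and> (\<forall>x\<in>carrier G. q (inv\<^bsub>G\<^esub> x) = q x)"

definition nondegenerate_quadratic_form ::
    "('a, 'm) monoid_scheme \<Rightarrow> ('a \<Rightarrow> rat_mod_int) \<Rightarrow> bool" where
  "nondegenerate_quadratic_form G q \<longleftrightarrow>
    quadratic_form G q \<and> linking_pairing G (assoc_bilinear G q)"

definition isomorphic_quadratic ::
    "('a, 'm) monoid_scheme \<Rightarrow> ('a \<Rightarrow> rat_mod_int) \<Rightarrow>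
     ('b, 'n) monoid_scheme \<Rightarrow> ('b \<Rightarrow> rat_mod_int) \<Rightarrow> bool" where
  "isomorphic_quadratic G q G' q' \<longleftrightarrow>
    (\<exists>\<theta>\<in>iso G G'. \<forall>x\<in>carrier G. q x = q' (\<theta> x))"

definition isomorphic_pairing ::
    "('a, 'm) monoid_scheme \<Rightarrow> ('a \<Rightarrow> 'a \<Rightarrow> rat_mod_int) \<Rightarrow>
     ('b, 'n) monoid_scheme \<Rightarrow> ('b \<Rightarrow> 'b \<Rightarrow> rat_mod_int) \<Rightarrow> bool" where
  "isomorphic_pairing G b G' b' \<longleftrightarrow>
    (\<exists>\<theta>\<in>iso G G'. \<forall>x\<in>carrier G. \<forall>y\<in>carrier G. b x y = b' (\<theta> x) (\<theta> y))"

definition gauss_sum :: "('a, 'm) monoid_scheme \<Rightarrow> ('a \<Rightarrow> rat_mod_int) \<Rightarrow> complex" where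
  "gauss_sum G q =
    (1 / of_real (sqrt (real (card (bilinear_ker G (assoc_bilinear G q)) * card (carrier G))))) *
    (\<Sum>x\<in>carrier G. exp_2pi_i (q x))"

text \<open>The type \<open>8\<close> is the ring of integers modulo 8, and $e^{2 i \pi k / 8}$ depends exactly
  on the class of \<open>k\<close> in it. The description denotes only when the Gauss sum is an 8th root of
  unity, which is the case for nondegenerate forms on finite abelian groups.\<close>

definition gauss_brown :: "('a, 'm) monoid_scheme \<Rightarrow> ('a \<Rightarrow> rat_mod_int) \<Rightarrow> 8" where
  "gauss_brown G q =
    (THE B. \<exists>k::int. B = of_int k \<and> gauss_sum G q = exp (2 * \<i> * of_real pi / 8 * of_int k))"

lemma gauss_brown_eqI:
  assumes "gauss_sum G q = exp (2 * \<i> * of_real pi / 8 * of_int k)"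
  shows "gauss_brown G q = of_int k"
  unfolding gauss_brown_def
proof (rule the_equality)
  show "\<exists>k'::int. (of_int k :: 8) = of_int k' \<and>
      gauss_sum G q = exp (2 * \<i> * of_real pi / 8 * of_int k')"
    using assms by blast
next
  fix B :: 8
  assume "\<exists>l::int. B = of_int l \<and> gauss_sum G q = exp (2 * \<i> * of_real pi / 8 * of_int l)"
  then obtain l :: int where B: "B = of_int l"
    and l: "gauss_sum G q = exp (2 * \<i> * of_real pi / 8 * of_int l)"
    by blast
  have "exp (2 * \<i> * of_real pi / 8 * of_int l)
      = exp (2 * \<i> * of_real pi / 8 * of_int k)"
    using l assms by (simp only:)
  then obtain n :: int where
    "2 * \<i> * of_real pi / 8 * of_int l
      = 2 * \<i> * of_real pi / 8 * of_int k + of_real (real_of_int (2 * n) * pi) * \<i>"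
    unfolding exp_eq by blast
  then have "2 * \<i> * of_real pi / 8 * (of_int l - of_int k - 8 * of_int n) = 0"
    by (simp add: field_simps)
  then have "(of_int l - of_int k - 8 * of_int n :: complex) = 0"
    by simp
  then have "of_int l = (of_int (k + 8 * n) :: complex)"
    by (simp add: algebra_simps)
  then have "l = k + 8 * n"
    by (simp only: of_int_eq_iff)
  moreover have "(8 :: 8) = 0"
    by simp
  then have "of_int (k + 8 * n) = (of_int k :: 8)"
    by (simp only: of_int_add of_int_mult of_int_numeral mult_zero_left add_0_right)
  ultimately show "B = of_int k"
    using B by (simp only:)
qed

end

theory Submission
  imports Defs
begin

text \<open>The substantial implication reduces, by transport of structure, to two forms $q, q'$ with the
  same pairing $b$ on one group. Then $q' - q$ is additive of order two, hence $q' - q = b(-, c)$ with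
  $2c = 0$, and $q'(x) = q(x + c) - q(c)$, so that the Gauss sums differ by the factor
  $e^{-2 i \pi q(c)}$. If they agree then $q(c) = 0$, and the involution fixing $x$ when $b(x, c) = 0$
  and sending $x$ to $x + c$ otherwise is an isometry from $q'$ to $q$.

  This needs that the Gauss sums are 8th roots of unity, since otherwise the Gauss-Brown invariant
  is a junk value. Write $2|G| - 1$ as a sum of four squares. Multiplication by the quaternion with
  these coordinates is an automorphism of $G^4$ which turns $q^{\oplus 4}$ into
  $(2|G| - 1) q^{\oplus 4} = - q^{\oplus 4}$. So the fourth power of the Gauss sum is real, and
  its absolute value is 1.\<close>

section \<open>Sums of four squares\<close>

text \<open>Multiplicativity of the quaternion norm: the right side is the norm of
  \<open>w + xi + yj + zk\<close> times the conjugate of \<open>a + bi + cj + dk\<close>. The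
  conjugate makes the first coordinate an inner product, as the descent requires.\<close>

lemma euler_four_squares:
  fixes a :: "'a::comm_ring_1"
  shows "(a\<^sup>2 + b\<^sup>2 + c\<^sup>2 + d\<^sup>2) * (w\<^sup>2 + x\<^sup>2 + y\<^sup>2 + z\<^sup>2) =
    (a*w + b*x + c*y + d*z)\<^sup>2 + (a*x - b*w + c*z - d*y)\<^sup>2 +
    (a*y - c*w + d*x - b*z)\<^sup>2 + (a*z - d*w + b*y - c*x)\<^sup>2"
  by (simp add: power2_eq_square algebra_simps)

definition four_squares :: "int \<Rightarrow> bool" where
  "four_squares n \<longleftrightarrow> (\<exists>a b c d. n = a\<^sup>2 + b\<^sup>2 + c\<^sup>2 + d\<^sup>2)"

lemma four_squaresI: "n = a\<^sup>2 + b\<^sup>2 + c\<^sup>2 + d\<^sup>2 \<Longrightarrow> four_squares n"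
  unfolding four_squares_def by blast

lemma four_squares_mult: "four_squares m \<Longrightarrow> four_squares n \<Longrightarrow> four_squares (m * n)"
  unfolding four_squares_def by (metis euler_four_squares)

text \<open>\<open>p\<close> divides \<open>(x - y) * (x + y)\<close>, while both factors are
  smaller than \<open>p\<close> in absolute value.\<close>

lemma sq_mod_inj_half:
  fixes p :: int
  assumes p: "Factorial_Ring.prime p" and x: "0 \<le> x" "2 * x < p" and y: "0 \<le> y" "2 * y < p"
    and eq: "x\<^sup>2 mod p = y\<^sup>2 mod p"
  shows "x = y"
proof -
  have "p dvd x\<^sup>2 - y\<^sup>2" using eq by (simp add: mod_eq_dvd_iff)
  then have "p dvd (x - y) * (x + y)" by (simp add: power2_eq_square algebra_simps)
  then have "p dvd x - y \<or> p dvd x + y" using p by (simp add: prime_dvd_mult_iff)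
  then show ?thesis
  proof
    assume d: "p dvd x - y"
    show ?thesis
    proof (rule ccontr)
      assume "x \<noteq> y"
      then have "\<bar>p\<bar> \<le> \<bar>x - y\<bar>" using d by (intro dvd_imp_le_int) auto
      then show False using x y by linarith
    qed
  next
    assume d: "p dvd x + y"
    show ?thesis
    proof (cases "x + y = 0")
      case True
      then show ?thesis using x y by linarith
    next
      case False
      then show ?thesis using zdvd_imp_le[OF d] x y by linarith
    qed
  qed
qed

text \<open>Pigeonhole: with \<open>p = 2 * h + 1\<close>, the squares and the numbers
  \<open>- 1 - y\<^sup>2\<close> each occupy \<open>h + 1\<close> residue classes, so they share
  one.\<close>

lemma ex_two_squares_plus_one:
  fixes p :: int
  assumes p: "Factorial_Ring.prime p" and odd: "odd p"
  shows "\<exists>x y. 0 \<le> x \<and> 2 * x < p \<and> 0 \<le> y \<and> 2 * y < p \<and> p dvd x\<^sup>2 + y\<^sup>2 + 1"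
proof -
  have p2: "p > 2" using p odd by (metis even_numeral order_le_less prime_ge_2_int)
  obtain h where h: "p = 2 * h + 1" using odd by (auto elim: oddE)
  define A where "A = (\<lambda>x. x\<^sup>2 mod p) ` {0..h}"
  define B where "B = (\<lambda>y. (- 1 - y\<^sup>2) mod p) ` {0..h}"
  have injA: "inj_on (\<lambda>x. x\<^sup>2 mod p) {0..h}"
    by (rule inj_onI) (use p h in \<open>auto intro!: sq_mod_inj_half[of p]\<close>)
  have injB: "inj_on (\<lambda>y. (- 1 - y\<^sup>2) mod p) {0..h}"
  proof (rule inj_onI)
    fix x y assume xy: "x \<in> {0..h}" "y \<in> {0..h}" "(- 1 - x\<^sup>2) mod p = (- 1 - y\<^sup>2) mod p"
    then have "p dvd y\<^sup>2 - x\<^sup>2" by (simp add: mod_eq_dvd_iff)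
    then have "y\<^sup>2 mod p = x\<^sup>2 mod p" by (simp add: mod_eq_dvd_iff)
    then show "x = y" using xy p h sq_mod_inj_half[of p x y] by auto
  qed
  have "A \<union> B \<subseteq> {0..<p}" using p2 by (auto simp: A_def B_def)
  then have "card (A \<union> B) \<le> card {0..<p}" by (intro card_mono) auto
  moreover have "card A + card B > card {0..<p}"
    using injA injB h p2 by (simp add: A_def B_def card_image)
  moreover have "finite A" "finite B" by (auto simp: A_def B_def)
  ultimately have "A \<inter> B \<noteq> {}" using card_Un_disjoint[of A B] by auto
  then obtain z where "z \<in> A" "z \<in> B" by blast
  then obtain x y where xy: "x \<in> {0..h}" "y \<in> {0..h}" "x\<^sup>2 mod p = (- 1 - y\<^sup>2) mod p"
    unfolding A_def B_def by blast
  then have "p dvd x\<^sup>2 - (- 1 - y\<^sup>2)" by (simp only: mod_eq_dvd_iff)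
  then have "p dvd x\<^sup>2 + y\<^sup>2 + 1" by (simp add: algebra_simps)
  then show ?thesis using xy h by (intro exI[of _ x] exI[of _ y]) auto
qed

lemma ex_minimal_residue:
  fixes x m :: int
  assumes "m > 0"
  shows "\<exists>y k. x = y + m * k \<and> 2 * \<bar>y\<bar> \<le> m"
proof (cases "2 * (x mod m) \<le> m")
  case True
  have "x = x mod m + m * (x div m)" by simp
  moreover have "2 * \<bar>x mod m\<bar> \<le> m" using True assms by simp
  ultimately show ?thesis by blast
next
  case False
  have "x = (x mod m - m) + m * (x div m + 1)" by (simp add: algebra_simps)
  moreover have "2 * \<bar>x mod m - m\<bar> \<le> m"
    using False pos_mod_bound[OF assms, of x] by (simp add: abs_if)
  ultimately show ?thesis by blast
qed

text \<open>Replacing the four roots by their smallest residues modulo \<open>m\<close> gives a sum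
  of squares \<open>m * r\<close> with \<open>r\<close> at most \<open>m\<close>. In Euler's
  identity for the product \<open>(m * p) * (m * r)\<close> every coordinate is divisible by
  \<open>m\<close>, and dividing by \<open>m\<^sup>2\<close> leaves \<open>r * p\<close>.\<close>

lemma four_squares_descent:
  fixes p m :: int
  assumes p: "Factorial_Ring.prime p" and m: "1 < m" "m < p" and fs: "four_squares (m * p)"
  shows "\<exists>r. 0 < r \<and> r < m \<and> four_squares (r * p)"
proof -
  obtain x1 x2 x3 x4 where x: "m * p = x1\<^sup>2 + x2\<^sup>2 + x3\<^sup>2 + x4\<^sup>2"
    using fs unfolding four_squares_def by blast
  have m0: "m > 0" using m by simp
  obtain y1 k1 where 1: "x1 = y1 + m * k1" "2 * \<bar>y1\<bar> \<le> m" using ex_minimal_residue[OF m0] by blast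
  obtain y2 k2 where 2: "x2 = y2 + m * k2" "2 * \<bar>y2\<bar> \<le> m" using ex_minimal_residue[OF m0] by blast
  obtain y3 k3 where 3: "x3 = y3 + m * k3" "2 * \<bar>y3\<bar> \<le> m" using ex_minimal_residue[OF m0] by blast
  obtain y4 k4 where 4: "x4 = y4 + m * k4" "2 * \<bar>y4\<bar> \<le> m" using ex_minimal_residue[OF m0] by blast
  define Y where "Y = y1\<^sup>2 + y2\<^sup>2 + y3\<^sup>2 + y4\<^sup>2"
  define D where "D = 2 * (y1 * k1 + y2 * k2 + y3 * k3 + y4 * k4)"
  define K where "K = k1\<^sup>2 + k2\<^sup>2 + k3\<^sup>2 + k4\<^sup>2"
  have mp: "m * p = Y + m * D + m\<^sup>2 * K"
    unfolding x 1(1) 2(1) 3(1) 4(1) Y_def D_def K_def by (simp add: power2_eq_square algebra_simps)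
  \<comment> \<open>This is the quotient of \<open>Y\<close> by \<open>m\<close>, read off from the
    expansion of \<open>m * p\<close>.\<close>
  define r where "r = p - D - m * K"
  have Y: "Y = m * r" using mp by (simp add: r_def algebra_simps power2_eq_square)
  have sq: "4 * y\<^sup>2 \<le> m\<^sup>2" if "2 * \<bar>y\<bar> \<le> m" for y :: int
    using power_mono[OF that, of 2] by (simp add: power_mult_distrib)
  note b = sq[OF 1(2)] sq[OF 2(2)] sq[OF 3(2)] sq[OF 4(2)]
  have "Y \<ge> 0" by (simp add: Y_def)
  then have r0: "r \<ge> 0" using Y m0 by (simp add: zero_le_mult_iff)
  have "m * r \<le> m * m" using b by (simp add: Y[symmetric] Y_def power2_eq_square)
  then have rm: "r \<le> m" using m0 by simp
  \<comment> \<open>Each of the extreme values \<open>r = 0\<close> and \<open>r = m\<close> would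
    make \<open>m\<close> a divisor of the prime \<open>p\<close>.\<close>
  have notdvd: "\<not> m dvd p"
    using p m unfolding prime_int_iff by (metis less_imp_le less_irrefl m0)
  have "r \<noteq> 0"
  proof
    assume "r = 0"
    then have "Y = 0" using Y by simp
    then have "y1\<^sup>2 = 0 \<and> y2\<^sup>2 = 0 \<and> y3\<^sup>2 = 0 \<and> y4\<^sup>2 = 0"
      unfolding Y_def by (smt (verit) zero_le_power2)
    then have "D = 0" by (simp add: D_def)
    then have "p = m * K" using \<open>r = 0\<close> by (simp add: r_def)
    then show False using notdvd by simp
  qed
  moreover have "r \<noteq> m"
  proof
    assume "r = m"
    then have "Y = m\<^sup>2" using Y by (simp add: power2_eq_square)
    \<comment> \<open>Each term is at most a quarter of \<open>m\<^sup>2\<close>, so a total of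
      \<open>m\<^sup>2\<close> forces equality in all four.\<close>
    then have e: "4 * y1\<^sup>2 = m\<^sup>2" "4 * y2\<^sup>2 = m\<^sup>2" "4 * y3\<^sup>2 = m\<^sup>2" "4 * y4\<^sup>2 = m\<^sup>2"
      using b unfolding Y_def by linarith+
    have dv: "m dvd 2 * y" if "4 * y\<^sup>2 = m\<^sup>2" for y
    proof -
      have "(2 * y)\<^sup>2 = m\<^sup>2" using that by (simp add: power_mult_distrib)
      then show ?thesis unfolding power2_eq_iff by auto
    qed
    have "D = (2 * y1) * k1 + (2 * y2) * k2 + (2 * y3) * k3 + (2 * y4) * k4"
      by (simp add: D_def)
    then have "m dvd D" using e[THEN dv] by simp
    moreover have "p = m + D + m * K" using \<open>r = m\<close> by (simp add: r_def)
    ultimately show False using notdvd by simp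
  qed
  ultimately have r: "0 < r" "r < m" using r0 rm by auto
  \<comment> \<open>The Euler coordinates divided by \<open>m\<close>: substituting
    \<open>x1 = y1 + m * k1\<close> and its analogues, the terms free of \<open>m\<close> add up to
    \<open>Y = m * r\<close> in the first coordinate and cancel in the other three.\<close>
  define w1 where "w1 = r + (k1 * y1 + k2 * y2 + k3 * y3 + k4 * y4)"
  define w2 where "w2 = k1 * y2 - k2 * y1 + k3 * y4 - k4 * y3"
  define w3 where "w3 = k1 * y3 - k3 * y1 + k4 * y2 - k2 * y4"
  define w4 where "w4 = k1 * y4 - k4 * y1 + k2 * y3 - k3 * y2"
  have z1: "x1 * y1 + x2 * y2 + x3 * y3 + x4 * y4 = m * w1"
    using Y unfolding Y_def 1(1) 2(1) 3(1) 4(1) w1_def by (simp add: power2_eq_square algebra_simps)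
  have z2: "x1 * y2 - x2 * y1 + x3 * y4 - x4 * y3 = m * w2"
    unfolding 1(1) 2(1) 3(1) 4(1) w2_def by (simp add: algebra_simps)
  have z3: "x1 * y3 - x3 * y1 + x4 * y2 - x2 * y4 = m * w3"
    unfolding 1(1) 2(1) 3(1) 4(1) w3_def by (simp add: algebra_simps)
  have z4: "x1 * y4 - x4 * y1 + x2 * y3 - x3 * y2 = m * w4"
    unfolding 1(1) 2(1) 3(1) 4(1) w4_def by (simp add: algebra_simps)
  have "(m * p) * (m * r) = (m * w1)\<^sup>2 + (m * w2)\<^sup>2 + (m * w3)\<^sup>2 + (m * w4)\<^sup>2"
    unfolding x Y[symmetric] Y_def euler_four_squares z1 z2 z3 z4 ..
  then have "m\<^sup>2 * (r * p) = m\<^sup>2 * (w1\<^sup>2 + w2\<^sup>2 + w3\<^sup>2 + w4\<^sup>2)"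
    by (simp add: power_mult_distrib power2_eq_square algebra_simps)
  then have "r * p = w1\<^sup>2 + w2\<^sup>2 + w3\<^sup>2 + w4\<^sup>2" using m0 by simp
  then show ?thesis using r four_squaresI by blast
qed

text \<open>For odd \<open>p\<close>, some multiple \<open>m * p\<close> with
  \<open>0 < m < p\<close> has the form \<open>x\<^sup>2 + y\<^sup>2 + 1\<close>; the descent lowers
  \<open>m\<close> until it is 1.\<close>

lemma four_squares_prime:
  fixes p :: int
  assumes p: "Factorial_Ring.prime p"
  shows "four_squares p"
proof (cases "p = 2")
  case True
  then show ?thesis by (intro four_squaresI[of _ 1 1 0 0]) simp
next
  case False
  then have odd: "odd p" using p by (metis prime_ge_2_int order_le_less prime_odd_int)
  obtain x y where xy: "0 \<le> x" "2 * x < p" "0 \<le> y" "2 * y < p" "p dvd x\<^sup>2 + y\<^sup>2 + 1"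
    using ex_two_squares_plus_one[OF p odd] by blast
  then obtain m where m: "x\<^sup>2 + y\<^sup>2 + 1 = p * m" by (auto elim: dvdE)
  have p1: "p > 1" using p by (rule prime_gt_1_int)
  have m0: "m > 0"
  proof -
    have "p * m > 0" unfolding m[symmetric] by (simp add: add_nonneg_pos)
    then show ?thesis using p1 by (simp add: zero_less_mult_iff)
  qed
  \<comment> \<open>Since \<open>x\<close> and \<open>y\<close> lie below \<open>p / 2\<close>, the
    two squares contribute less than half of \<open>p\<^sup>2\<close>, which yields
    \<open>m < p\<close>.\<close>
  have "(2 * x)\<^sup>2 < p\<^sup>2" "(2 * y)\<^sup>2 < p\<^sup>2" using xy by (intro power_strict_mono; simp)+
  moreover have "p\<^sup>2 \<ge> 2\<^sup>2" using p1 by (intro power_mono) auto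
  ultimately have "x\<^sup>2 + y\<^sup>2 + 1 < p * p" by (simp add: power2_eq_square)
  then have mp: "m < p" using m p1 by simp
  have "four_squares (m * p)"
    by (rule four_squaresI[of _ x y 1 0]) (use m in \<open>simp add: algebra_simps\<close>)
  then show ?thesis using m0 mp
  proof (induction "nat m" arbitrary: m rule: less_induct)
    case less
    show ?case
    proof (cases "m = 1")
      case True
      then show ?thesis using less.prems by simp
    next
      case False
      then obtain r where "0 < r" "r < m" "four_squares (r * p)"
        using four_squares_descent[OF p, of m] less.prems by auto
      then show ?thesis using less.hyps[of r] less.prems by auto
    qed
  qed
qed

theorem lagrange_four_squares: "four_squares (int n)"
proof (induction n rule: prime_divisors_induct)
  case zero
  then show ?case by (intro four_squaresI[of _ 0 0 0 0]) simp
next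
  case (unit n)
  then show ?case by (intro four_squaresI[of _ 1 0 0 0]) simp
next
  case (factor p n)
  then show ?case using four_squares_prime[of "int p"] by (simp add: four_squares_mult)
qed

section \<open>The group of rationals modulo one\<close>

lemma exp_2pi_i_0 [simp]: "exp_2pi_i 0 = 1"
  by transfer simp

lemma exp_2pi_i_add: "exp_2pi_i (x + y) = exp_2pi_i x * exp_2pi_i y"
  by transfer (simp add: of_rat_add algebra_simps exp_add)

lemma of_rat_complex: "of_rat r = complex_of_real (of_rat r)"
  by (cases r) (simp add: of_rat_rat)

lemma exp_2pi_i_uminus: "exp_2pi_i (- x) = cnj (exp_2pi_i x)"
proof (transfer)
  fix r :: rat
  have "cnj (2 * \<i> * of_real pi * of_rat r) = 2 * \<i> * of_real pi * of_rat (- r)"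
    by (simp add: of_rat_minus of_rat_complex)
  then show "exp (2 * \<i> * of_real pi * of_rat (- r)) = cnj (exp (2 * \<i> * of_real pi * of_rat r))"
    by (simp only: exp_cnj)
qed

text \<open>Faithfulness of the character is what lets identities between Gauss sums be read back in
  Q/Z.\<close>

lemma exp_2pi_i_eq_1_iff: "exp_2pi_i x = 1 \<longleftrightarrow> x = 0"
proof (transfer)
  fix r :: rat
  show "exp (2 * \<i> * of_real pi * of_rat r) = 1 \<longleftrightarrow> r - 0 \<in> \<int>"
  proof
    assume "exp (2 * \<i> * of_real pi * of_rat r) = 1"
    then obtain n :: int where n: "Im (2 * \<i> * of_real pi * of_rat r) = of_int (2 * n) * pi"
      unfolding exp_eq_1 by blast
    have "real_of_rat r = of_rat (of_int n)" using n by (simp add: of_rat_complex)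
    then have "r = of_int n" by (simp only: of_rat_eq_iff)
    then show "r - 0 \<in> \<int>" by simp
  next
    assume "r - 0 \<in> \<int>"
    then obtain n where "r = of_int n" by (auto elim: Ints_cases)
    then show "exp (2 * \<i> * of_real pi * of_rat r) = 1"
      by (auto simp: exp_eq_1 intro!: exI[of _ n])
  qed
qed

text \<open>The integer action is lifted from the rationals, so that identities involving it can be
  checked on rational representatives.\<close>

lift_definition int_scale :: "int \<Rightarrow> rat_mod_int \<Rightarrow> rat_mod_int" is "\<lambda>k r. of_int k * r"
  by (simp flip: right_diff_distrib)

lemma rat_mod_int_lift: "\<exists>r. x = abs_rat_mod_int r"
  by (induction x rule: rat_mod_int.abs_induct) blast

lemma int_scale_add_left: "int_scale (k + l) r = int_scale k r + int_scale l r"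
  by transfer (simp add: algebra_simps)

lemma int_scale_add_right: "int_scale k (r + s) = int_scale k r + int_scale k s"
  by transfer (simp add: algebra_simps)

lemma int_scale_int_scale: "int_scale k (int_scale l r) = int_scale (k * l) r"
  by transfer (simp add: algebra_simps)

lemma int_scale_0 [simp]: "int_scale 0 r = 0"
  by transfer simp

lemma int_scale_1 [simp]: "int_scale 1 r = r"
  by transfer simp

lemma int_scale_uminus_1: "int_scale (- 1) r = - r"
  by transfer simp

lemma int_scale_2: "int_scale 2 r = r + r"
  by transfer simp

text \<open>The class of 1/2 is the only element of order two in Q/Z: if \<open>t + t\<close> is the
  integer \<open>m\<close> and \<open>t\<close> is not an integer, then \<open>m\<close> is
  odd.\<close>

lemma two_torsion_nonzero_unique:
  assumes "r + r = (0::rat_mod_int)" and "r \<noteq> 0" and "s + s = (0::rat_mod_int)" and "s \<noteq> 0"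
  shows "r = s"
  using assms
proof (transfer)
  fix r s :: rat
  assume r: "r + r - 0 \<in> \<int>" "\<not> r - 0 \<in> \<int>" and s: "s + s - 0 \<in> \<int>" "\<not> s - 0 \<in> \<int>"
  have half: "\<exists>k::int. t = of_int k + 1/2" if t: "t + t - 0 \<in> \<int>" "\<not> t - 0 \<in> \<int>" for t :: rat
  proof -
    obtain m where m: "t + t = of_int m" using t(1) by (auto elim: Ints_cases)
    have "odd m"
    proof
      assume "even m"
      then obtain j where "m = 2 * j" by blast
      then have "t = of_int j" using m by simp
      then show False using t(2) by simp
    qed
    then obtain j where "m = 2 * j + 1" by (auto elim: oddE)
    then have "t = of_int j + 1/2" using m by simp
    then show ?thesis by blast
  qed
  obtain k l :: int where "r = of_int k + 1/2" "s = of_int l + 1/2" using half r s by meson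
  then show "r - s \<in> \<int>" by simp
qed

section \<open>Characters and quaternion action\<close>

context comm_group
begin

section \<open>Additive maps to Q/Z and their character sums\<close>

definition additive :: "('a \<Rightarrow> rat_mod_int) \<Rightarrow> bool" where
  "additive f \<longleftrightarrow> (\<forall>x\<in>carrier G. \<forall>y\<in>carrier G. f (x \<otimes> y) = f x + f y)"

lemma additiveD: "additive f \<Longrightarrow> x \<in> carrier G \<Longrightarrow> y \<in> carrier G \<Longrightarrow> f (x \<otimes> y) = f x + f y"
  by (simp add: additive_def)

lemma additive_one: "additive f \<Longrightarrow> f \<one> = 0"
  using additiveD[of f \<one> \<one>] by simp

lemma additive_inv: "additive f \<Longrightarrow> x \<in> carrier G \<Longrightarrow> f (inv x) = - f x"
  using additiveD[of f x "inv x"] additive_one[of f] by (simp add: eq_neg_iff_add_eq_0 add.commute)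

lemma additive_nat_pow:
  assumes "additive f" "x \<in> carrier G"
  shows "f (x [^] (n::nat)) = int_scale (int n) (f x)"
proof (induction n)
  case 0
  then show ?case using assms by (simp add: additive_one)
next
  case (Suc n)
  then show ?case using assms
    by (simp add: additiveD int_scale_add_left add.commute)
qed

lemma additive_int_pow:
  assumes "additive f" "x \<in> carrier G"
  shows "f (x [^] (k::int)) = int_scale k (f x)"
proof (cases k rule: int_cases2)
  case (nonneg n)
  then show ?thesis using additive_nat_pow[OF assms] by (simp add: int_pow_int)
next
  case (nonpos n)
  have "f (x [^] k) = - int_scale (int n) (f x)"
    using assms nonpos by (simp add: int_pow_neg_int additive_inv additive_nat_pow)
  also have "\<dots> = int_scale k (f x)"
    unfolding int_scale_uminus_1[symmetric] int_scale_int_scale nonpos by simp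
  finally show ?thesis .
qed

lemma pow_card_eq_1: "x \<in> carrier G \<Longrightarrow> x [^] card (carrier G) = \<one>"
  using pow_order_eq_1[of x] by (simp add: Coset.order_def)

lemma sum_carrier_translate:
  assumes "z \<in> carrier G"
  shows "(\<Sum>x\<in>carrier G. F (x \<otimes> z)) = (\<Sum>x\<in>carrier G. F x)"
  by (rule sum.reindex_bij_witness[of _ "\<lambda>x. x \<otimes> inv z" "\<lambda>x. x \<otimes> z"])
     (use assms in \<open>auto simp: m_assoc\<close>)

text \<open>Translation by \<open>z\<close> permutes the terms and multiplies the sum by
  \<open>exp_2pi_i (f z)\<close>, which differs from 1.\<close>

lemma character_sum_eq_0:
  assumes f: "additive f" and z: "z \<in> carrier G" "f z \<noteq> 0"
  shows "(\<Sum>x\<in>carrier G. exp_2pi_i (f x)) = 0"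
proof -
  let ?S = "\<Sum>x\<in>carrier G. exp_2pi_i (f x)"
  have "?S = (\<Sum>x\<in>carrier G. exp_2pi_i (f (x \<otimes> z)))"
    using z by (simp add: sum_carrier_translate[where F = "\<lambda>x. exp_2pi_i (f x)"])
  also have "\<dots> = ?S * exp_2pi_i (f z)"
    using f z by (simp add: additiveD exp_2pi_i_add sum_distrib_right)
  finally have "?S * (exp_2pi_i (f z) - 1) = 0" by (simp add: algebra_simps)
  then show ?thesis using z by (simp add: exp_2pi_i_eq_1_iff)
qed

section \<open>Integer quaternions acting on the fourth power of the group\<close>

definition lin_comb :: "int \<Rightarrow> int \<Rightarrow> int \<Rightarrow> int \<Rightarrow> 'a \<Rightarrow> 'a \<Rightarrow> 'a \<Rightarrow> 'a \<Rightarrow> 'a" where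
  "lin_comb a b c d x y z w = x [^] a \<otimes> y [^] b \<otimes> z [^] c \<otimes> w [^] d"

lemma lin_comb_closed [simp]:
  "x \<in> carrier G \<Longrightarrow> y \<in> carrier G \<Longrightarrow> z \<in> carrier G \<Longrightarrow> w \<in> carrier G \<Longrightarrow>
    lin_comb a b c d x y z w \<in> carrier G"
  by (simp add: lin_comb_def)

lemma lin_comb_int_pow:
  assumes "x \<in> carrier G" "y \<in> carrier G" "z \<in> carrier G" "w \<in> carrier G"
  shows "lin_comb a b c d x y z w [^] (k::int) = lin_comb (k * a) (k * b) (k * c) (k * d) x y z w"
  using assms by (simp add: lin_comb_def int_pow_distrib int_pow_pow mult.commute)

lemma lin_comb_mult:
  assumes "x \<in> carrier G" "y \<in> carrier G" "z \<in> carrier G" "w \<in> carrier G"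
  shows "lin_comb a b c d x y z w \<otimes> lin_comb a' b' c' d' x y z w =
    lin_comb (a + a') (b + b') (c + c') (d + d') x y z w"
  using assms by (simp add: lin_comb_def int_pow_mult m_ac)

text \<open>In additive terms this is the product of a row vector with a 4 by 4 integer
  matrix.\<close>

lemma lin_comb_lin_comb:
  assumes "x \<in> carrier G" "y \<in> carrier G" "z \<in> carrier G" "w \<in> carrier G"
  shows "lin_comb a b c d (lin_comb a1 b1 c1 d1 x y z w) (lin_comb a2 b2 c2 d2 x y z w)
      (lin_comb a3 b3 c3 d3 x y z w) (lin_comb a4 b4 c4 d4 x y z w) =
    lin_comb (a * a1 + b * a2 + c * a3 + d * a4) (a * b1 + b * b2 + c * b3 + d * b4)
      (a * c1 + b * c2 + c * c3 + d * c4) (a * d1 + b * d2 + c * d3 + d * d4) x y z w"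
  unfolding lin_comb_def[of a b c d] using assms
  by (simp only: lin_comb_int_pow lin_comb_mult)

text \<open>Left multiplication by \<open>a + bi + cj + dk\<close>, where
  \<open>(x, y, z, w)\<close> stands for the quaternion \<open>x + yi + zj + wk\<close> with
  coefficients in the group.\<close>

definition quaternion_mult :: "int \<Rightarrow> int \<Rightarrow> int \<Rightarrow> int \<Rightarrow> 'a \<times> 'a \<times> 'a \<times> 'a \<Rightarrow> 'a \<times> 'a \<times> 'a \<times> 'a" where
  "quaternion_mult a b c d = (\<lambda>(x, y, z, w).
    (lin_comb a (- b) (- c) (- d) x y z w, lin_comb b a (- d) c x y z w,
     lin_comb c d a (- b) x y z w, lin_comb d (- c) b a x y z w))"

abbreviation carrier4 :: "('a \<times> 'a \<times> 'a \<times> 'a) set" where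
  "carrier4 \<equiv> carrier G \<times> carrier G \<times> carrier G \<times> carrier G"

text \<open>A quaternion multiplied by its conjugate is its norm.\<close>

lemma quaternion_mult_conj:
  assumes "t \<in> carrier4" and n: "n = a\<^sup>2 + b\<^sup>2 + c\<^sup>2 + d\<^sup>2"
  shows "quaternion_mult a (- b) (- c) (- d) (quaternion_mult a b c d t) =
    (case t of (x, y, z, w) \<Rightarrow> (x [^] n, y [^] n, z [^] n, w [^] n))"
proof -
  obtain x y z w where t: "t = (x, y, z, w)"
    and mem: "x \<in> carrier G" "y \<in> carrier G" "z \<in> carrier G" "w \<in> carrier G"
    using assms(1) by auto
  have "lin_comb n 0 0 0 x y z w = x [^] n" "lin_comb 0 n 0 0 x y z w = y [^] n"
    "lin_comb 0 0 n 0 x y z w = z [^] n" "lin_comb 0 0 0 n x y z w = w [^] n"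
    using mem by (simp_all add: lin_comb_def)
  then show ?thesis
    unfolding t quaternion_mult_def using mem
    by (simp add: lin_comb_lin_comb n power2_eq_square algebra_simps)
qed

text \<open>The norm is -1 modulo the group order, so following the map by multiplication with the
  conjugate gives inversion. Hence the map is injective, and finiteness makes it surjective.\<close>

lemma quaternion_mult_bij:
  assumes fin: "finite (carrier G)" and n: "n = a\<^sup>2 + b\<^sup>2 + c\<^sup>2 + d\<^sup>2"
    and dvd: "int (card (carrier G)) dvd n + 1"
  shows "bij_betw (quaternion_mult a b c d) carrier4 carrier4"
proof -
  have pow: "x [^] n = inv x" if x: "x \<in> carrier G" for x
  proof -
    obtain k where "n + 1 = int (card (carrier G)) * k" using dvd by (auto elim: dvdE)
    then have "n = int (card (carrier G)) * k + - 1" by simp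
    then have "x [^] n = (x [^] int (card (carrier G))) [^] k \<otimes> x [^] (- 1 :: int)"
      using x by (simp add: int_pow_pow flip: int_pow_mult)
    also have "\<dots> = inv x" using x by (simp add: int_pow_int pow_card_eq_1 int_pow_neg)
    finally show ?thesis .
  qed
  have inj: "inj_on (quaternion_mult a b c d) carrier4"
  proof (rule inj_onI)
    fix s t assume st: "s \<in> carrier4" "t \<in> carrier4"
      and eq: "quaternion_mult a b c d s = quaternion_mult a b c d t"
    obtain x y z w x' y' z' w' where t: "s = (x, y, z, w)" "t = (x', y', z', w')"
      by (metis prod_cases4)
    have "inv x = inv x' \<and> inv y = inv y' \<and> inv z = inv z' \<and> inv w = inv w'"
      using quaternion_mult_conj[OF st(1) n] quaternion_mult_conj[OF st(2) n] st
      unfolding eq unfolding t by (simp add: pow)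
    then show "s = t" using st by (simp add: t inj_on_eq_iff[OF inv_inj])
  qed
  have "quaternion_mult a b c d ` carrier4 \<subseteq> carrier4"
    by (auto simp: quaternion_mult_def)
  then have "quaternion_mult a b c d ` carrier4 = carrier4"
    using fin inj by (intro endo_inj_surj) auto
  then show ?thesis using inj by (simp add: bij_betw_def)
qed

end

section \<open>Gauss sums\<close>

locale quadratic_group = comm_group G for G (structure) +
  fixes q :: "'a \<Rightarrow> rat_mod_int"
  assumes fin: "finite (carrier G)"
    and nondeg: "nondegenerate_quadratic_form G q"
begin

abbreviation b where "b \<equiv> assoc_bilinear G q"

section \<open>Identities for the form and its pairing\<close>

lemma card_pos: "card (carrier G) > 0"
  using fin by (auto simp: card_gt_0_iff)

lemma q_mult: "q (x \<otimes> y) = q x + q y + b x y"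
  by (simp add: assoc_bilinear_def)

lemma b_mult:
  assumes "x \<in> carrier G" "y \<in> carrier G" "z \<in> carrier G"
  shows "b (x \<otimes> y) z = b x z + b y z" "b x (y \<otimes> z) = b x y + b x z"
  using nondeg assms
  unfolding nondegenerate_quadratic_form_def linking_pairing_def bilinear_map_def by blast+

lemma b_commute: "x \<in> carrier G \<Longrightarrow> y \<in> carrier G \<Longrightarrow> b x y = b y x"
  by (simp add: assoc_bilinear_def m_comm)

lemma additive_b_left: "y \<in> carrier G \<Longrightarrow> additive (\<lambda>x. b x y)"
  by (simp add: additive_def b_mult)

lemma additive_b_right: "x \<in> carrier G \<Longrightarrow> additive (b x)"
  by (simp add: additive_def b_mult)

lemma b_int_pow:
  assumes "x \<in> carrier G" "y \<in> carrier G"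
  shows "b (x [^] (k::int)) y = int_scale k (b x y)" "b x (y [^] k) = int_scale k (b x y)"
  using additive_int_pow[OF additive_b_left[of y]] additive_int_pow[OF additive_b_right[of x]] assms
  by auto

lemma ker_b: "bilinear_ker G b = {\<one>}"
  using nondeg unfolding nondegenerate_quadratic_form_def linking_pairing_def by blast

lemma nondegenerate:
  assumes "x \<in> carrier G" "x \<noteq> \<one>"
  obtains y where "y \<in> carrier G" "b x y \<noteq> 0" "b y x \<noteq> 0"
proof -
  have "x \<notin> bilinear_ker G b" using ker_b assms(2) by blast
  then obtain y where y: "y \<in> carrier G" "b x y \<noteq> 0"
    using assms(1) unfolding bilinear_ker_def by blast
  moreover have "b y x \<noteq> 0" using y b_commute[OF assms(1) y(1)] by metis
  ultimately show ?thesis by (rule that)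
qed

lemma q_one [simp]: "q \<one> = 0"
  using q_mult[of \<one> \<one>] additive_one[OF additive_b_right, of \<one>] by simp

lemma q_inv: "x \<in> carrier G \<Longrightarrow> q (inv x) = q x"
  using nondeg unfolding nondegenerate_quadratic_form_def quadratic_form_def by blast

text \<open>Expand \<open>q (x \<otimes> inv x) = 0\<close> and use the symmetry
  \<open>q (inv x) = q x\<close>.\<close>

lemma b_self: "x \<in> carrier G \<Longrightarrow> b x x = q x + q x"
  using q_mult[of x "inv x"] additive_inv[OF additive_b_right, of x x]
  by (simp add: q_inv algebra_simps)

lemma q_nat_pow: "x \<in> carrier G \<Longrightarrow> q (x [^] (n::nat)) = int_scale ((int n)\<^sup>2) (q x)"
proof (induction n)
  case (Suc n)
  have "q (x [^] Suc n) = int_scale ((int n)\<^sup>2) (q x) + q x + int_scale (int n) (q x + q x)"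
    using Suc b_int_pow[of x x "int n"] by (simp add: q_mult b_self int_pow_int)
  also have "\<dots> = int_scale ((int n)\<^sup>2) (q x) + int_scale 1 (q x) +
      (int_scale (int n) (q x) + int_scale (int n) (q x))"
    by (simp add: int_scale_add_right)
  also have "\<dots> = int_scale ((int (Suc n))\<^sup>2) (q x)"
    unfolding int_scale_add_left[symmetric] by (simp add: power2_eq_square algebra_simps)
  finally show ?case .
qed simp

lemma q_int_pow: "x \<in> carrier G \<Longrightarrow> q (x [^] (k::int)) = int_scale (k\<^sup>2) (q x)"
  by (cases k rule: int_cases2) (simp_all add: int_pow_int int_pow_neg_int q_inv q_nat_pow)

text \<open>The group order kills \<open>b x x\<close>, which is twice \<open>q x\<close>. The order
  alone may fail to kill \<open>q x\<close>, as for the value 1/4 on a group of order two; this is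
  why the quaternion norm is taken to be \<open>2 * card - 1\<close>.\<close>

lemma int_scale_twice_order: "x \<in> carrier G \<Longrightarrow> int_scale (2 * int (card (carrier G))) (q x) = 0"
proof -
  assume x: "x \<in> carrier G"
  have "int_scale (int (card (carrier G)) * 2) (q x) = int_scale (int (card (carrier G))) (b x x)"
    using x by (simp add: b_self int_scale_2 flip: int_scale_int_scale)
  also have "\<dots> = b x (x [^] int (card (carrier G)))"
    using x by (simp add: b_int_pow)
  also have "\<dots> = 0"
    using x by (simp add: int_pow_int pow_card_eq_1 additive_one[OF additive_b_right])
  finally show ?thesis by (simp add: mult.commute)
qed

section \<open>Gauss sums are eighth roots of unity\<close>

lemma q_lin_comb:
  assumes "x \<in> carrier G" "y \<in> carrier G" "z \<in> carrier G" "w \<in> carrier G"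
  shows "q (lin_comb k l m n x y z w) =
    int_scale (k\<^sup>2) (q x) + int_scale (l\<^sup>2) (q y) + int_scale (m\<^sup>2) (q z) + int_scale (n\<^sup>2) (q w) +
    int_scale (k * l) (b x y) + int_scale (k * m) (b x z) + int_scale (k * n) (b x w) +
    int_scale (l * m) (b y z) + int_scale (l * n) (b y w) + int_scale (m * n) (b z w)"
  using assms
  by (simp add: lin_comb_def q_mult q_int_pow b_mult b_int_pow int_scale_int_scale int_scale_add_right algebra_simps)

definition q4 :: "'a \<times> 'a \<times> 'a \<times> 'a \<Rightarrow> rat_mod_int" where
  "q4 = (\<lambda>(x, y, z, w). q x + q y + q z + q w)"

text \<open>The columns of the multiplication matrix are pairwise orthogonal and each has squared
  length \<open>n\<close>: the pairing terms cancel and every value of \<open>q\<close> acquires the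
  factor \<open>n\<close>.\<close>

lemma q4_quaternion_mult:
  assumes "t \<in> carrier4" and n: "n = k\<^sup>2 + l\<^sup>2 + m\<^sup>2 + p\<^sup>2"
  shows "q4 (quaternion_mult k l m p t) = int_scale n (q4 t)"
proof -
  obtain x y z w where t: "t = (x, y, z, w)"
    and mem: "x \<in> carrier G" "y \<in> carrier G" "z \<in> carrier G" "w \<in> carrier G"
    using assms(1) by auto
  \<comment> \<open>With representatives fixed for all values of \<open>q\<close> and
    \<open>b\<close>, the claim becomes a polynomial identity over the rationals.\<close>
  obtain x1 y1 z1 w1 where lift_q: "q x = abs_rat_mod_int x1" "q y = abs_rat_mod_int y1"
    "q z = abs_rat_mod_int z1" "q w = abs_rat_mod_int w1"
    using rat_mod_int_lift by metis
  obtain b1 b2 b3 b4 b5 b6 where lift_b: "b x y = abs_rat_mod_int b1" "b x z = abs_rat_mod_int b2"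
    "b x w = abs_rat_mod_int b3" "b y z = abs_rat_mod_int b4" "b y w = abs_rat_mod_int b5"
    "b z w = abs_rat_mod_int b6"
    using rat_mod_int_lift by metis
  have "q4 (quaternion_mult k l m p t) =
      q (lin_comb k (- l) (- m) (- p) x y z w) + q (lin_comb l k (- p) m x y z w) +
      q (lin_comb m p k (- l) x y z w) + q (lin_comb p (- m) l k x y z w)"
    by (simp add: t q4_def quaternion_mult_def)
  also have "\<dots> = int_scale n (q4 t)"
    unfolding q_lin_comb[OF mem] q4_def t prod.case lift_q lift_b
      int_scale.abs_eq plus_rat_mod_int.abs_eq n
    by (rule arg_cong[of _ _ abs_rat_mod_int]) (simp add: power2_eq_square algebra_simps)
  finally show ?thesis .
qed

lemma sum_exp_q4:
  "(\<Sum>t\<in>carrier4. exp_2pi_i (q4 t)) = (\<Sum>x\<in>carrier G. exp_2pi_i (q x)) ^ 4"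
proof -
  have "(\<Sum>t\<in>carrier4. exp_2pi_i (q4 t)) =
      (\<Sum>x\<in>carrier G. \<Sum>y\<in>carrier G. \<Sum>z\<in>carrier G. \<Sum>w\<in>carrier G.
        exp_2pi_i (q x) * (exp_2pi_i (q y) * (exp_2pi_i (q z) * exp_2pi_i (q w))))"
    by (simp add: q4_def exp_2pi_i_add sum.cartesian_product' mult.assoc)
  then show ?thesis
    by (simp only: sum_distrib_left[symmetric] sum_distrib_right[symmetric]
        power4_eq_xxxx mult.assoc)
qed

text \<open>The fourth power is the exponential sum of \<open>q4\<close>. Reindexing it along
  multiplication by a quaternion of norm \<open>2 * card - 1\<close> replaces \<open>q4\<close> by
  its negative, which conjugates the sum.\<close>

lemma exp_sum_pow4_real:
  "cnj ((\<Sum>x\<in>carrier G. exp_2pi_i (q x)) ^ 4) = (\<Sum>x\<in>carrier G. exp_2pi_i (q x)) ^ 4"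
proof -
  let ?N = "2 * int (card (carrier G))"
  \<comment> \<open>Lagrange's theorem is stated for naturals; positivity of the order rules out
    truncation in \<open>nat\<close>.\<close>
  have "int (nat (?N - 1)) = ?N - 1" using card_pos by simp
  then obtain k l m p where n: "?N - 1 = k\<^sup>2 + l\<^sup>2 + m\<^sup>2 + p\<^sup>2"
    using lagrange_four_squares[of "nat (?N - 1)"] unfolding four_squares_def by metis
  have bij: "bij_betw (quaternion_mult k l m p) carrier4 carrier4"
    by (rule quaternion_mult_bij[OF fin n]) simp
  have neg: "q4 (quaternion_mult k l m p t) = - q4 t" if t: "t \<in> carrier4" for t
  proof -
    have "int_scale ?N (q4 t) = 0"
      using t by (auto simp: q4_def int_scale_add_right int_scale_twice_order)
    then have "int_scale (?N + - 1) (q4 t) = - q4 t"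
      unfolding int_scale_add_left int_scale_uminus_1 by simp
    then show ?thesis using q4_quaternion_mult[OF t n] by simp
  qed
  have "(\<Sum>t\<in>carrier4. exp_2pi_i (q4 t)) = (\<Sum>t\<in>carrier4. exp_2pi_i (q4 (quaternion_mult k l m p t)))"
    by (rule sum.reindex_bij_betw[OF bij, symmetric])
  also have "\<dots> = (\<Sum>t\<in>carrier4. cnj (exp_2pi_i (q4 t)))"
    using neg by (intro sum.cong) (auto simp: exp_2pi_i_uminus)
  finally show ?thesis unfolding sum_exp_q4[symmetric] by simp
qed

text \<open>In the double sum, substitute \<open>x \<otimes> y\<close> for \<open>x\<close>. The
  exponent becomes \<open>q x + b x y\<close>, and by nondegeneracy summation over \<open>y\<close>
  kills every term except \<open>x = \<one>\<close>.\<close>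

lemma exp_sum_mult_cnj:
  "(\<Sum>x\<in>carrier G. exp_2pi_i (q x)) * cnj (\<Sum>x\<in>carrier G. exp_2pi_i (q x)) = of_nat (card (carrier G))"
proof -
  have "(\<Sum>x\<in>carrier G. exp_2pi_i (q x)) * cnj (\<Sum>x\<in>carrier G. exp_2pi_i (q x)) =
      (\<Sum>y\<in>carrier G. \<Sum>x\<in>carrier G. exp_2pi_i (q x - q y))"
    unfolding cnj_sum sum_product diff_conv_add_uminus exp_2pi_i_add exp_2pi_i_uminus
    by (rule sum.swap)
  also have "\<dots> = (\<Sum>y\<in>carrier G. \<Sum>x\<in>carrier G. exp_2pi_i (q (x \<otimes> y) - q y))"
    by (intro sum.cong refl sum_carrier_translate[symmetric, where F = "\<lambda>x. exp_2pi_i (q x - q _)"])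
  also have "\<dots> = (\<Sum>x\<in>carrier G. \<Sum>y\<in>carrier G. exp_2pi_i (q x) * exp_2pi_i (b x y))"
    by (subst sum.swap) (simp add: q_mult exp_2pi_i_add[symmetric] add.commute)
  also have "\<dots> = (\<Sum>x\<in>carrier G. if x = \<one> then of_nat (card (carrier G)) else 0)"
  proof (intro sum.cong refl)
    fix x assume x: "x \<in> carrier G"
    show "(\<Sum>y\<in>carrier G. exp_2pi_i (q x) * exp_2pi_i (b x y)) =
      (if x = \<one> then of_nat (card (carrier G)) else 0)"
    proof (cases "x = \<one>")
      case True
      then show ?thesis
        by (simp add: additive_one[OF additive_b_left])
    next
      case False
      then obtain y where "y \<in> carrier G" "b x y \<noteq> 0" using x nondegenerate by blast
      then have "(\<Sum>y\<in>carrier G. exp_2pi_i (b x y)) = 0"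
        using character_sum_eq_0[OF additive_b_right[OF x]] by blast
      then show ?thesis using False by (simp flip: sum_distrib_left)
    qed
  qed
  also have "\<dots> = of_nat (card (carrier G))" using fin by simp
  finally show ?thesis .
qed

lemma gauss_sum_eq:
  "gauss_sum G q = (\<Sum>x\<in>carrier G. exp_2pi_i (q x)) / of_real (sqrt (real (card (carrier G))))"
  unfolding gauss_sum_def ker_b by simp

lemma gauss_sum_nonzero: "gauss_sum G q \<noteq> 0"
proof
  assume "gauss_sum G q = 0"
  then have "(\<Sum>x\<in>carrier G. exp_2pi_i (q x)) = 0"
    using card_pos by (simp add: gauss_sum_eq)
  then show False using exp_sum_mult_cnj card_pos by (simp del: cnj_sum)
qed

text \<open>As \<open>S ^ 4\<close> is real, \<open>S ^ 8\<close> equals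
  \<open>(S * cnj S) ^ 4\<close>, the fourth power of the group order, which the normalisation
  cancels.\<close>

lemma gauss_sum_pow8: "gauss_sum G q ^ 8 = 1"
proof -
  define S where "S = (\<Sum>x\<in>carrier G. exp_2pi_i (q x))"
  have "S ^ 8 = S ^ 4 * S ^ 4" by (simp flip: power_add)
  also have "\<dots> = (S * cnj S) ^ 4"
    using exp_sum_pow4_real by (simp add: S_def power_mult_distrib)
  also have "\<dots> = of_nat (card (carrier G)) ^ 4" unfolding S_def exp_sum_mult_cnj ..
  finally have "S ^ 8 = of_nat (card (carrier G)) ^ 4" .
  moreover have "complex_of_real (sqrt (real (card (carrier G)))) ^ 8 = of_nat (card (carrier G)) ^ 4"
  proof -
    have "complex_of_real (sqrt (real (card (carrier G)))) ^ 8 =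
        ((complex_of_real (sqrt (real (card (carrier G)))))\<^sup>2) ^ 4"
      unfolding power_mult[symmetric] by simp
    also have "(complex_of_real (sqrt (real (card (carrier G)))))\<^sup>2 = of_nat (card (carrier G))"
      unfolding of_real_power[symmetric] by simp
    finally show ?thesis .
  qed
  ultimately show ?thesis
    using card_pos by (simp add: gauss_sum_eq S_def[symmetric] power_divide)
qed

section \<open>Forms with the same pairing\<close>

lemma additive_eq_b:
  assumes f: "additive f"
  shows "\<exists>c\<in>carrier G. \<forall>x\<in>carrier G. f x = b x c"
proof (rule ccontr)
  assume neg: "\<not> ?thesis"
  have *: "(\<Sum>x\<in>carrier G. exp_2pi_i (f x - b x c)) = 0" if c: "c \<in> carrier G" for c
  proof -
    obtain z where "z \<in> carrier G" "f z \<noteq> b z c" using neg c by blast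
    moreover have "additive (\<lambda>x. f x - b x c)"
      using f c by (simp add: additive_def b_mult algebra_simps)
    ultimately show ?thesis using character_sum_eq_0[of "\<lambda>x. f x - b x c" z] by simp
  qed
  \<comment> \<open>Double counting: each inner sum over \<open>x\<close> vanishes because
    \<open>f\<close> differs from every \<open>b x c\<close> as a map of \<open>x\<close>, whereas
    summing over \<open>c\<close> first leaves only \<open>x = \<one>\<close> and gives the group
    order.\<close>
  have "0 = (\<Sum>c\<in>carrier G. \<Sum>x\<in>carrier G. exp_2pi_i (f x - b x c))" using * by simp
  also have "\<dots> = (\<Sum>x\<in>carrier G. \<Sum>c\<in>carrier G. exp_2pi_i (f x) * cnj (exp_2pi_i (b x c)))"
    by (subst sum.swap) (simp add: diff_conv_add_uminus exp_2pi_i_add exp_2pi_i_uminus del: add_uminus_conv_diff)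
  also have "\<dots> = (\<Sum>x\<in>carrier G. exp_2pi_i (f x) * cnj (\<Sum>c\<in>carrier G. exp_2pi_i (b x c)))"
    by (simp add: sum_distrib_left)
  also have "\<dots> = (\<Sum>x\<in>carrier G. if x = \<one> then of_nat (card (carrier G)) else 0)"
  proof (intro sum.cong refl)
    fix x assume x: "x \<in> carrier G"
    show "exp_2pi_i (f x) * cnj (\<Sum>c\<in>carrier G. exp_2pi_i (b x c)) =
      (if x = \<one> then of_nat (card (carrier G)) else 0)"
    proof (cases "x = \<one>")
      case True
      then show ?thesis
        by (simp add: additive_one[OF additive_b_left] additive_one[OF f])
    next
      case False
      then obtain y where "y \<in> carrier G" "b x y \<noteq> 0" using x nondegenerate by blast
      then have "(\<Sum>y\<in>carrier G. exp_2pi_i (b x y)) = 0"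
        using character_sum_eq_0[OF additive_b_right[OF x]] by blast
      then show ?thesis using False by simp
    qed
  qed
  also have "\<dots> = of_nat (card (carrier G))" using fin by simp
  finally show False using card_pos by simp
qed

lemma isometry_same_pairing:
  assumes "quadratic_group G q'" and b_eq: "\<And>x y. x \<in> carrier G \<Longrightarrow> y \<in> carrier G \<Longrightarrow>
      assoc_bilinear G q' x y = b x y"
    and gauss: "gauss_sum G q = gauss_sum G q'"
  shows "isomorphic_quadratic G q' G q"
proof -
  interpret q': quadratic_group G q' by fact
  have add: "additive (\<lambda>x. q' x - q x)"
    unfolding additive_def using b_eq by (auto simp: q_mult q'.q_mult)
  then obtain c where c: "c \<in> carrier G" and qc: "\<And>x. x \<in> carrier G \<Longrightarrow> q' x - q x = b x c"
    using additive_eq_b[OF add] by blast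
  have q'_eq: "q' x = q (x \<otimes> c) - q c" if "x \<in> carrier G" for x
    using qc[OF that] by (simp add: q_mult algebra_simps)
  \<comment> \<open>Both \<open>q\<close> and \<open>q'\<close> double to the common diagonal
    \<open>b x x\<close>, so their difference is killed by 2.\<close>
  have b2: "b x c + b x c = 0" if x: "x \<in> carrier G" for x
    using b_eq[OF x x] x unfolding qc[OF x, symmetric] b_self[OF x] q'.b_self[OF x]
    by (simp add: algebra_simps)
  have c2: "c \<otimes> c = \<one>"
  proof (rule ccontr)
    assume "c \<otimes> c \<noteq> \<one>"
    then obtain y where "y \<in> carrier G" "b y (c \<otimes> c) \<noteq> 0" using c nondegenerate[of "c \<otimes> c"] by blast
    then show False using b2 c by (simp add: b_mult)
  qed
  have "(\<Sum>x\<in>carrier G. exp_2pi_i (q' x)) = (\<Sum>x\<in>carrier G. exp_2pi_i (q (x \<otimes> c)) * exp_2pi_i (- q c))"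
    using q'_eq by (simp flip: exp_2pi_i_add)
  also have "\<dots> = (\<Sum>x\<in>carrier G. exp_2pi_i (q x)) * exp_2pi_i (- q c)"
    unfolding sum_distrib_right[symmetric] sum_carrier_translate[OF c, of "\<lambda>x. exp_2pi_i (q x)"] ..
  finally have "gauss_sum G q' = gauss_sum G q * exp_2pi_i (- q c)"
    by (simp add: gauss_sum_eq q'.gauss_sum_eq)
  then have "exp_2pi_i (- q c) = 1" using gauss gauss_sum_nonzero by simp
  then have qc0: "q c = 0" by (simp add: exp_2pi_i_eq_1_iff)
  \<comment> \<open>This makes \<open>b x c\<close> invariant under
    \<open>x \<mapsto> x \<otimes> c\<close>, so the map defined next is an involution.\<close>
  have bcc: "b c c = 0" using b_self[OF c] qc0 by simp
  define \<theta> where "\<theta> x = (if b x c = 0 then x else x \<otimes> c)" for x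
  have cl: "\<theta> x \<in> carrier G" if "x \<in> carrier G" for x
    using that c by (simp add: \<theta>_def)
  have "\<theta> (\<theta> x) = x" if "x \<in> carrier G" for x
    using that c bcc c2 by (simp add: \<theta>_def b_mult m_assoc)
  then have bij: "bij_betw \<theta> (carrier G) (carrier G)"
    using cl by (intro bij_betwI[where g = \<theta>]) auto
  have hom: "\<theta> (x \<otimes> y) = \<theta> x \<otimes> \<theta> y" if xy: "x \<in> carrier G" "y \<in> carrier G" for x y
  proof (cases "b x c = 0 \<or> b y c = 0")
    case True
    then show ?thesis using xy c by (auto simp: \<theta>_def b_mult m_ac)
  next
    case False
    \<comment> \<open>Both values are the class of 1/2, so they cancel in
      \<open>b (x \<otimes> y) c\<close>; on the other side the two factors \<open>c\<close>
      cancel.\<close>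
    then have "b x c = b y c" using two_torsion_nonzero_unique b2 xy by blast
    then have "b (x \<otimes> y) c = 0" using b2 xy c by (simp add: b_mult)
    moreover have "x \<otimes> c \<otimes> (y \<otimes> c) = x \<otimes> y \<otimes> (c \<otimes> c)" using xy c by (simp add: m_ac)
    ultimately show ?thesis using False xy c2 by (simp add: \<theta>_def)
  qed
  \<comment> \<open>If \<open>b x c\<close> vanishes, the forms agree at \<open>x\<close>; otherwise
    \<open>q (x \<otimes> c)\<close> expands to \<open>q x + b x c\<close>, which is
    \<open>q' x\<close>.\<close>
  have "q' x = q (\<theta> x)" if "x \<in> carrier G" for x
    using qc[OF that] qc0 by (auto simp: \<theta>_def q_mult diff_eq_eq add.commute)
  moreover have "\<theta> \<in> iso G G" using bij cl hom by (auto simp: iso_def hom_def)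
  ultimately show ?thesis unfolding isomorphic_quadratic_def by blast
qed

text \<open>The description in \<open>gauss_brown\<close> recovers the exponent once the Gauss sum
  is known to be an eighth root of unity, so equal invariants then give equal sums.\<close>

lemma gauss_brown_cong_gauss_sum:
  assumes "quadratic_group G' q'" and "gauss_brown G q = gauss_brown G' q'"
  shows "gauss_sum G q = gauss_sum G' q'"
proof -
  interpret q': quadratic_group G' q' by fact
  have root: "\<exists>j<8. z = exp (2 * \<i> * of_real pi / 8 * of_int (int j))" if "z ^ 8 = 1" for z :: complex
  proof -
    have "z \<in> {z. z ^ 8 = 1}" using that by simp
    then obtain j where "j < 8" "z = exp (2 * of_real pi * \<i> * of_nat j / of_nat 8)"
      unfolding complex_roots_unity[OF one_le_numeral] by blast
    then show ?thesis by (intro exI[of _ j]) (simp add: mult_ac)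
  qed
  obtain i j where i: "i < 8" "gauss_sum G q = exp (2 * \<i> * of_real pi / 8 * of_int (int i))"
    and j: "j < 8" "gauss_sum G' q' = exp (2 * \<i> * of_real pi / 8 * of_int (int j))"
    using root gauss_sum_pow8 q'.gauss_sum_pow8 by metis
  have "(of_int (int i) :: 8) = of_int (int j)"
    using assms(2) gauss_brown_eqI[OF i(2)] gauss_brown_eqI[OF j(2)] by simp
  \<comment> \<open>Distinct integers in the range 0 to 7 stay distinct modulo 8.\<close>
  then have "i = j"
    using i(1) j(1) by (simp add: bit0.of_int_eq Abs_bit0'_def Abs_bit0_inject)
  then show ?thesis using i j by simp
qed

end

section \<open>The equivalence, by transport to a single group\<close>

theorem theorem2:
  fixes G :: "('a, 'm) monoid_scheme" and G' :: "('b, 'n) monoid_scheme"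
    and q :: "'a \<Rightarrow> rat_mod_int" and q' :: "'b \<Rightarrow> rat_mod_int"
  assumes "comm_group G" and "finite (carrier G)"
    and "comm_group G'" and "finite (carrier G')"
    and "nondegenerate_quadratic_form G q"
    and "nondegenerate_quadratic_form G' q'"
  shows "isomorphic_quadratic G q G' q' \<longleftrightarrow>
    isomorphic_pairing G (assoc_bilinear G q) G' (assoc_bilinear G' q') \<and>
    gauss_brown G q = gauss_brown G' q'"
proof -
  interpret G: comm_group G by fact
  interpret G': comm_group G' by fact
  interpret Q: quadratic_group G q using assms by unfold_locales
  interpret Q': quadratic_group G' q' using assms by unfold_locales
  \<comment> \<open>Isometry invariance of the Gauss sum is stated for arbitrary forms because it
    serves both directions: for \<open>q\<close> itself and for the pullback of
    \<open>q'\<close>.\<close>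
  have gauss: "gauss_sum G r = gauss_sum G' r'"
    if Q1: "quadratic_group G r" and Q2: "quadratic_group G' r'" and th: "\<theta> \<in> iso G G'"
      and r: "\<And>x. x \<in> carrier G \<Longrightarrow> r x = r' (\<theta> x)" for r r' \<theta>
  proof -
    have bij: "bij_betw \<theta> (carrier G) (carrier G')" using th by (simp add: iso_def)
    then have "card (carrier G) = card (carrier G')" by (rule bij_betw_same_card)
    moreover have "(\<Sum>x\<in>carrier G. exp_2pi_i (r x)) = (\<Sum>x\<in>carrier G'. exp_2pi_i (r' x))"
      using r sum.reindex_bij_betw[OF bij, of "\<lambda>x. exp_2pi_i (r' x)"] by simp
    ultimately show ?thesis
      using quadratic_group.gauss_sum_eq[OF Q1] quadratic_group.gauss_sum_eq[OF Q2] by simp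
  qed
  show ?thesis
  proof
    assume "isomorphic_quadratic G q G' q'"
    then obtain \<theta> where th: "\<theta> \<in> iso G G'" and q: "\<And>x. x \<in> carrier G \<Longrightarrow> q x = q' (\<theta> x)"
      unfolding isomorphic_quadratic_def by blast
    have "\<theta> (x \<otimes>\<^bsub>G\<^esub> y) = \<theta> x \<otimes>\<^bsub>G'\<^esub> \<theta> y" if "x \<in> carrier G" "y \<in> carrier G" for x y
      using th that by (simp add: iso_def hom_mult)
    then have "assoc_bilinear G q x y = assoc_bilinear G' q' (\<theta> x) (\<theta> y)"
      if "x \<in> carrier G" "y \<in> carrier G" for x y
      using that q by (simp add: assoc_bilinear_def)
    then have "isomorphic_pairing G (assoc_bilinear G q) G' (assoc_bilinear G' q')"
      using th unfolding isomorphic_pairing_def by blast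
    moreover have "gauss_sum G q = gauss_sum G' q'"
      using gauss th q Q.quadratic_group_axioms Q'.quadratic_group_axioms by blast
    then have "gauss_brown G q = gauss_brown G' q'" by (simp add: gauss_brown_def)
    ultimately show "isomorphic_pairing G (assoc_bilinear G q) G' (assoc_bilinear G' q') \<and>
      gauss_brown G q = gauss_brown G' q'" ..
  next
    assume R: "isomorphic_pairing G (assoc_bilinear G q) G' (assoc_bilinear G' q') \<and>
      gauss_brown G q = gauss_brown G' q'"
    then obtain \<theta> where th: "\<theta> \<in> iso G G'"
      and b: "\<And>x y. x \<in> carrier G \<Longrightarrow> y \<in> carrier G \<Longrightarrow>
        assoc_bilinear G q x y = assoc_bilinear G' q' (\<theta> x) (\<theta> y)"
      unfolding isomorphic_pairing_def by blast
    have cl: "\<theta> x \<in> carrier G'" if "x \<in> carrier G" for x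
      using th that by (auto simp: iso_def hom_in_carrier)
    have mult: "\<theta> (x \<otimes>\<^bsub>G\<^esub> y) = \<theta> x \<otimes>\<^bsub>G'\<^esub> \<theta> y" if "x \<in> carrier G" "y \<in> carrier G" for x y
      using th that by (simp add: iso_def hom_mult)
    have inv: "\<theta> (inv\<^bsub>G\<^esub> x) = inv\<^bsub>G'\<^esub> (\<theta> x)" if "x \<in> carrier G" for x
      using th that group_hom.hom_inv[of G G' \<theta> x]
      by (simp add: iso_def group_hom_def group_hom_axioms_def G.is_group G'.is_group)
    \<comment> \<open>The pullback of \<open>q'\<close> along \<open>\<theta>\<close> lives on
      \<open>G\<close> and has the same pairing as \<open>q\<close>.\<close>
    define r where "r x = q' (\<theta> x)" for x
    have br: "assoc_bilinear G r x y = assoc_bilinear G q x y"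
      if "x \<in> carrier G" "y \<in> carrier G" for x y
      using that b by (simp add: assoc_bilinear_def r_def mult)
    have "bilinear_map G (assoc_bilinear G r)"
      by (simp add: bilinear_map_def br Q.b_mult)
    moreover have "r (inv\<^bsub>G\<^esub> x) = r x" if "x \<in> carrier G" for x
      using that cl by (simp add: r_def inv Q'.q_inv)
    moreover have "bilinear_ker G (assoc_bilinear G r) = {\<one>\<^bsub>G\<^esub>}"
      using Q.ker_b by (simp add: bilinear_ker_def br cong: conj_cong)
    ultimately have "nondegenerate_quadratic_form G r"
      unfolding nondegenerate_quadratic_form_def quadratic_form_def linking_pairing_def
      by (simp add: br Q.b_commute)
    then interpret R: quadratic_group G r using assms by unfold_locales
    have "gauss_sum G r = gauss_sum G' q'"
      using gauss[OF R.quadratic_group_axioms Q'.quadratic_group_axioms th] by (simp add: r_def)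
    also have "\<dots> = gauss_sum G q"
      using Q.gauss_brown_cong_gauss_sum[OF Q'.quadratic_group_axioms] R by simp
    \<comment> \<open>Here \<open>r\<close> is the base form and \<open>q\<close> the competing one,
      so the isometry runs from \<open>q\<close> to \<open>r\<close> and can be followed by
      \<open>\<theta>\<close>.\<close>
    finally have "isomorphic_quadratic G q G r"
      by (intro R.isometry_same_pairing) (simp_all add: br Q.quadratic_group_axioms)
    then obtain \<eta> where eta: "\<eta> \<in> iso G G" "\<And>x. x \<in> carrier G \<Longrightarrow> q x = r (\<eta> x)"
      unfolding isomorphic_quadratic_def by blast
    have "\<theta> \<circ> \<eta> \<in> iso G G'" using eta(1) th by (rule iso_set_trans)
    moreover have "q x = q' ((\<theta> \<circ> \<eta>) x)" if "x \<in> carrier G" for x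
      using eta(2)[OF that] by (simp add: r_def)
    ultimately show "isomorphic_quadratic G q G' q'"
      unfolding isomorphic_quadratic_def by blast
  qed
qed

end
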